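(* Let $n_1,n_2\ge 2$, let $S_{n_1,n_2}$ be the double star on $n_1+n_2$ vertices, and let $k\ge3$. Then the spectrum of the Seidel matrix of the uniform double hyperstar $S_{n_1,n_2}^k$ is $$\sigma_S(S_{n_1,n_2}^k)=\begin{pmatrix}1 & -2k+3 & r_1 & r_2 & r_3 & r_4 & r_5\\ (k-2)(n_1+n_2-1)-1 & n_1+n_2-4 & 1&1&1&1&1\end{pmatrix},$$ where $r_1,\dots,r_5$ are the eigenvalues (with multiplicity) of the quotient matrix $$Q=\begin{bmatrix} 0 & -(n_1-1)(k-1) & -1 & (n_2-1)(k-1) & 2-k\\ -1 & (n_1-3)(k-1)+1 & 1 & (n_2-1)(k-1) & k-2\\ -1 & (n_1-1)(k-1) & 0 & -(n_2-1)(k-1) & 2-k\\ 1 & (n_1-1)(k-1) & -1 & (n_2-3)(k-1)+1 & k-2\\ -1 & (n_1-1)(k-1) & -1 & (n_2-1)(k-1) & 3-k \end{bmatrix}.$$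
   Context: A hypergraph $G^*=(V,E)$ has a finite vertex set $V=\{v_1,\dots,v_N\}$ and a finite set $E$ of hyperedges, each a subset of $V$. Its adjacency matrix $A=(a_{ij})$ has $a_{ij}=|\{e\in E:\{v_i,v_j\}\subset e\}|$ for $i\ne j$ and $a_{ii}=0$. Its Seidel matrix is $S=J_N-I_N-2A$ ($J_N$ all-ones matrix, $I_N$ identity). A star $S_n$ is the tree on $n$ vertices with one central vertex joined to the $n-1$ other vertices. The double star $S_{n_1,n_2}$ is the graph obtained from disjoint stars $S_{n_1}$ and $S_{n_2}$ by adding an edge joining their central vertices. The uniform double hyperstar $S_{n_1,n_2}^k$ is the $k$-th power of $S_{n_1,n_2}$: the $k$-uniform hypergraph obtained by adding to each edge of $S_{n_1,n_2}$ its own $k-2$ new vertices (pairwise disjoint sets for different edges). $Q$ is the quotient matrix (matrix of block row sums) of the Seidel matrix for the equitable partition of the vertices into: the centre of $S_{n_1}$; the $(n_1-1)(k-1)$ degree-one vertices of hyperedges coming from $S_{n_1}$; the centre of $S_{n_2}$; the $(n_2-1)(k-1)$ degree-one vertices of hyperedges coming from $S_{n_2}$; the $k-2$ vertices added to the edge joining the two centres. The two-row notation for a spectrum lists eigenvalues in the first row and multiplicities in the second; it is read as a multiset (if listed values coincide, their multiplicities add, and multiplicity $0$ means the entry is absent). *)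

theory Defs
  imports
    "Jordan_Normal_Form.Char_Poly"
    "HOL-Library.Disjoint_Sets"
    "HOL-Computational_Algebra.Polynomial"
begin

record 'v hypergraph =
  verts :: "'v set"
  hyperedges :: "'v set set"

definition is_hypergraph :: "'v hypergraph \<Rightarrow> bool" where
  "is_hypergraph H \<longleftrightarrow> finite (verts H) \<and> (\<forall>e\<in>hyperedges H. e \<subseteq> verts H)"

definition uniform :: "nat \<Rightarrow> 'v hypergraph \<Rightarrow> bool" where
  "uniform k H \<longleftrightarrow> (\<forall>e\<in>hyperedges H. card e = k)"

definition vertex_degree :: "'v hypergraph \<Rightarrow> 'v \<Rightarrow> nat" where
  "vertex_degree H v = card {e \<in> hyperedges H. v \<in> e}"

text \<open>The list \<open>vs\<close> is an enumeration \<open>v\<^sub>1, \<dots>, v\<^sub>N\<close> (without repetition) of the vertices of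
  the hypergraph, indexed from 0.\<close>

definition adjacency_mat :: "'v list \<Rightarrow> 'v hypergraph \<Rightarrow> real mat" where
  "adjacency_mat vs H = mat (length vs) (length vs)
     (\<lambda>(i, j). if i = j then 0 else real (card {e \<in> hyperedges H. {vs ! i, vs ! j} \<subseteq> e}))"

definition seidel_mat :: "'v list \<Rightarrow> 'v hypergraph \<Rightarrow> real mat" where
  "seidel_mat vs H =
     mat (length vs) (length vs) (\<lambda>_. 1) - 1\<^sub>m (length vs) - 2 \<cdot>\<^sub>m adjacency_mat vs H"

text \<open>The spectrum of a square real matrix: the multiset of its complex eigenvalues, counted with
  algebraic multiplicity. For the (symmetric) Seidel matrix this is also the geometric
  multiplicity; a quotient matrix need not be symmetric.\<close>

definition spectrum_mset :: "real mat \<Rightarrow> complex multiset" where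
  "spectrum_mset M = proots (char_poly (map_mat complex_of_real M))"

text \<open>\<open>P\<close> lists the blocks of an equitable partition of the row and column indices of \<open>M\<close>, and \<open>Q\<close>
  is the matrix of the (constant) block row sums.\<close>

definition equitable_quotient :: "real mat \<Rightarrow> nat set list \<Rightarrow> real mat \<Rightarrow> bool" where
  "equitable_quotient M P Q \<longleftrightarrow>
     distinct P \<and> partition_on {..<dim_row M} (set P) \<and>
     M \<in> carrier_mat (dim_row M) (dim_row M) \<and> Q \<in> carrier_mat (length P) (length P) \<and>
     (\<forall>a<length P. \<forall>b<length P. \<forall>i\<in>P ! a. (\<Sum>j\<in>P ! b. M $$ (i, j)) = Q $$ (a, b))"

definition index_block :: "'v list \<Rightarrow> 'v set \<Rightarrow> nat set" where
  "index_block vs B = {i. i < length vs \<and> vs ! i \<in> B}"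

text \<open>A graph is represented by the hypergraph of its edges, viewed as two-element sets.
  The star \<open>S\<^sub>n\<close> lives on \<open>{0, \<dots>, n - 1}\<close>, with centre \<open>0\<close>.\<close>

definition star :: "nat \<Rightarrow> nat hypergraph" where
  "star n = \<lparr>verts = {..<n}, hyperedges = {{0, i} |i. 1 \<le> i \<and> i < n}\<rparr>"

definition double_star :: "nat \<Rightarrow> nat \<Rightarrow> (nat + nat) hypergraph" where
  "double_star n1 n2 =
     \<lparr>verts = Inl ` verts (star n1) \<union> Inr ` verts (star n2),
      hyperedges = (image Inl) ` hyperedges (star n1) \<union> (image Inr) ` hyperedges (star n2)
        \<union> {{Inl 0, Inr 0}}\<rparr>"

text \<open>In the \<open>k\<close>-th power of a graph, \<open>New e j\<close> (for \<open>j < k - 2\<close>) are the vertices added to the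
  edge \<open>e\<close>.\<close>

datatype 'v power_vertex = Old 'v | New "'v set" nat

definition power_edge :: "nat \<Rightarrow> 'v set \<Rightarrow> 'v power_vertex set" where
  "power_edge k e = Old ` e \<union> New e ` {..<k - 2}"

definition power_hypergraph :: "nat \<Rightarrow> 'v hypergraph \<Rightarrow> 'v power_vertex hypergraph" where
  "power_hypergraph k G =
     \<lparr>verts = Old ` verts G \<union> (\<Union>e\<in>hyperedges G. New e ` {..<k - 2}),
      hyperedges = power_edge k ` hyperedges G\<rparr>"

definition double_hyperstar :: "nat \<Rightarrow> nat \<Rightarrow> nat \<Rightarrow> (nat + nat) power_vertex hypergraph" where
  "double_hyperstar n1 n2 k = power_hypergraph k (double_star n1 n2)"

definition degree_one_verts ::
  "'v hypergraph \<Rightarrow> 'v set set \<Rightarrow> 'v set" where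
  "degree_one_verts H F = {v \<in> \<Union>F. vertex_degree H v = 1}"

definition double_hyperstar_blocks ::
  "nat \<Rightarrow> nat \<Rightarrow> nat \<Rightarrow> (nat + nat) power_vertex set list" where
  "double_hyperstar_blocks n1 n2 k =
     [{Old (Inl 0)},
      degree_one_verts (double_hyperstar n1 n2 k)
        (power_edge k ` (image Inl) ` hyperedges (star n1)),
      {Old (Inr 0)},
      degree_one_verts (double_hyperstar n1 n2 k)
        (power_edge k ` (image Inr) ` hyperedges (star n2)),
      New {Inl 0, Inr 0} ` {..<k - 2}]"

definition double_hyperstar_quotient :: "real \<Rightarrow> real \<Rightarrow> real \<Rightarrow> real mat" where
  "double_hyperstar_quotient n1 n2 k = mat_of_rows_list 5
     [[ 0, - (n1 - 1) * (k - 1),         -1, (n2 - 1) * (k - 1),       2 - k],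
      [-1, (n1 - 3) * (k - 1) + 1,        1, (n2 - 1) * (k - 1),       k - 2],
      [-1, (n1 - 1) * (k - 1),            0, - (n2 - 1) * (k - 1),     2 - k],
      [ 1, (n1 - 1) * (k - 1),           -1, (n2 - 3) * (k - 1) + 1,   k - 2],
      [-1, (n1 - 1) * (k - 1),           -1, (n2 - 1) * (k - 1),       3 - k]]"

lemma finite_hyperedges_star: "finite (hyperedges (star n))"
proof -
  have "hyperedges (star n) = (\<lambda>i. {0, i}) ` {1..<n}" by (auto simp: star_def)
  then show ?thesis by simp
qed

lemma finite_hyperedges_double_star: "finite (hyperedges (double_star n1 n2))"
  by (simp add: double_star_def finite_hyperedges_star)

lemma uniform_double_star: "uniform 2 (double_star n1 n2)"
  by (auto simp: uniform_def double_star_def star_def)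

lemma is_hypergraph_double_hyperstar:
  assumes "n1 \<ge> 1" "n2 \<ge> 1"
  shows "is_hypergraph (double_hyperstar n1 n2 k)"
proof -
  have "finite (verts (double_star n1 n2))"
    by (simp add: double_star_def star_def)
  moreover have "e \<subseteq> verts (double_star n1 n2)" if "e \<in> hyperedges (double_star n1 n2)" for e
    using that assms by (auto simp: double_star_def star_def)
  ultimately show ?thesis
    using finite_hyperedges_double_star
    by (fastforce simp: is_hypergraph_def double_hyperstar_def power_hypergraph_def power_edge_def)
qed

lemma uniform_double_hyperstar:
  assumes "k \<ge> 2"
  shows "uniform k (double_hyperstar n1 n2 k)"
proof -
  have "card (power_edge k e) = k" if "e \<in> hyperedges (double_star n1 n2)" for e
  proof -
    have e: "card e = 2"
      using that uniform_double_star by (auto simp: uniform_def)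
    then have "finite e" by (simp add: card_ge_0_finite)
    then have "card (power_edge k e) = card (Old ` e) + card (New e ` {..<k - 2})"
      unfolding power_edge_def by (intro card_Un_disjoint) auto
    also have "\<dots> = 2 + (k - 2)"
      using e by (simp add: card_image inj_on_def)
    finally show ?thesis using assms by simp
  qed
  then show ?thesis
    by (auto simp: uniform_def double_hyperstar_def power_hypergraph_def)
qed

end

theory Submission
  imports Defs
begin

text \<open>Let \<open>U\<close> be the indicator matrix of the five blocks and \<open>V\<close> that of the sets of \<open>k - 1\<close>
  degree-one vertices of the \<open>n\<^sub>1 + n\<^sub>2 - 2\<close> pendant hyperedges. Then \<open>S = L + U B\<close>, where
  \<open>L = I - 2 V V\<^sup>T\<close> and the rows of \<open>B\<close> are sign patterns that are constant on blocks. Since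
  \<open>L U = U D\<close> for a diagonal matrix \<open>D\<close> with entries \<open>1\<close> and \<open>3 - 2k\<close>, we have \<open>Q = D + B U\<close> and
  \<open>\<chi>\<^sub>S \<chi>\<^sub>D = \<chi>\<^sub>L \<chi>\<^sub>Q\<close>. The same identity applied to \<open>I + V (- 2 V\<^sup>T)\<close> gives \<open>\<chi>\<^sub>L\<close>, because
  \<open>V\<^sup>T V = (k - 1) I\<close>.\<close>

section \<open>Characteristic polynomials under intertwined updates\<close>

lemma char_poly_four_block_mat_upper_right_zero:
  fixes A :: "'a :: idom mat"
  assumes A: "A \<in> carrier_mat n n" and C: "C \<in> carrier_mat m n" and D: "D \<in> carrier_mat m m"
  shows "char_poly (four_block_mat A (0\<^sub>m n m) C D) = char_poly A * char_poly D"
proof -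
  have "char_poly_matrix (four_block_mat A (0\<^sub>m n m) C D)
      = four_block_mat (char_poly_matrix A) (0\<^sub>m n m) (map_mat (\<lambda>a. [:- a:]) C) (char_poly_matrix D)"
    by (rule eq_matI) (use A C D in \<open>auto simp: char_poly_matrix_def\<close>)
  then show ?thesis
    using A C D
    by (simp add: char_poly_def det_four_block_mat_upper_right_zero[of _ n _ m])
qed

text \<open>The column space of \<open>U\<close>, invariant under \<open>A\<close>, stays invariant
  when \<open>U * B\<close> is added. For a block indicator matrix \<open>U\<close> this says that
  block row sums are constant.\<close>

lemma intertwined_update:
  fixes A :: "'a :: comm_ring_1 mat"
  assumes A: "A \<in> carrier_mat n n" and U: "U \<in> carrier_mat n m" and B: "B \<in> carrier_mat m n"
    and D: "D \<in> carrier_mat m m" and AU: "A * U = U * D"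
  shows "(A + U * B) * U = U * (D + B * U)"
proof -
  have "(A + U * B) * U = A * U + U * B * U"
    by (rule add_mult_distrib_mat[OF A mult_carrier_mat[OF U B] U])
  also have "\<dots> = U * D + U * (B * U)"
    by (simp only: AU assoc_mult_mat[OF U B U])
  also have "\<dots> = U * (D + B * U)"
    by (rule mult_add_distrib_mat[OF U D mult_carrier_mat[OF B U], symmetric])
  finally show ?thesis .
qed

text \<open>For \<open>A = 0\<close> and \<open>D = 0\<close> this is the Sylvester identity
  relating \<open>U * B\<close> and \<open>B * U\<close>. Both sides are products, so that no
  polynomial has to be divided.\<close>

lemma char_poly_intertwined_update:
  fixes A :: "'a :: idom mat"
  assumes A: "A \<in> carrier_mat n n" and U: "U \<in> carrier_mat n m" and B: "B \<in> carrier_mat m n"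
    and D: "D \<in> carrier_mat m m" and AU: "A * U = U * D"
  shows "char_poly (A + U * B) * char_poly D = char_poly A * char_poly (D + B * U)"
proof -
  \<comment> \<open>conjugation by the block matrix \<open>[I, U; 0, I]\<close> turns \<open>[A, 0; B, D + B U]\<close> into \<open>[A + U B, 0; B, D]\<close>\<close>
  let ?K1 = "four_block_mat (A + U * B) (0\<^sub>m n m) B D"
  let ?K2 = "four_block_mat A (0\<^sub>m n m) B (D + B * U)"
  let ?P = "four_block_mat (1\<^sub>m n) U (0\<^sub>m m n) (1\<^sub>m m)"
  let ?R = "four_block_mat (1\<^sub>m n) (- U) (0\<^sub>m m n) (1\<^sub>m m)"
  note [simp] = A U B D
  have [simp]: "D + B * U \<in> carrier_mat m m" "A + U * B \<in> carrier_mat n n"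
    using mult_carrier_mat[OF B U] mult_carrier_mat[OF U B] by (auto intro!: add_carrier_mat)
  have [simp]: "U * 0\<^sub>m m n = 0\<^sub>m n n" "0\<^sub>m m n * U = 0\<^sub>m m m" "0\<^sub>m m n * - U = 0\<^sub>m m m"
    "0\<^sub>m m n * A = 0\<^sub>m m n" "(D + B * U) * 0\<^sub>m m n = 0\<^sub>m m n" "U * (D + B * U) \<in> carrier_mat n m"
    by (auto intro!: right_mult_zero_mat left_mult_zero_mat mult_carrier_mat[of _ _ m])
  have [simp]: "1\<^sub>m n * - U = - U" "U * 1\<^sub>m m = U"
    "1\<^sub>m n * U = U" "- U * 1\<^sub>m m = - U" "- U * 0\<^sub>m m n = 0\<^sub>m n n"
    by (auto simp: right_mult_zero_mat[of _ n m] left_mult_one_mat[of _ n m] right_mult_one_mat[of _ n m])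
  have [simp]: "- U + U = 0\<^sub>m n m" "U + - U = 0\<^sub>m n m"
    using carrier_matD[OF U] by (auto intro!: eq_matI)
  have PR: "?P * ?R = 1\<^sub>m (n + m)"
    by (subst mult_four_block_mat[of _ n n _ m _ m _ _ n _ m]) auto
  have RP: "?R * ?P = 1\<^sub>m (n + m)"
    by (subst mult_four_block_mat[of _ n n _ m _ m _ _ n _ m]) auto
  have PK: "?P * ?K2 = four_block_mat (A + U * B) (U * (D + B * U)) B (D + B * U)"
    by (subst mult_four_block_mat[of _ n n _ m _ m _ _ n _ m])
      (auto simp: left_mult_one_mat[OF A] left_mult_one_mat[OF B] left_add_zero_mat[OF B]
        left_mult_one_mat[of _ m m] left_add_zero_mat[of _ m m])
  \<comment> \<open>The upper right block of the conjugated matrix; this is where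
    \<open>A * U = U * D\<close> enters.\<close>
  have e1: "(A + U * B) * - U + U * (D + B * U) = 0\<^sub>m n m"
  proof -
    have "(A + U * B) * U = U * (D + B * U)"
      using A U B D AU by (rule intertwined_update)
    moreover have "(A + U * B) * U \<in> carrier_mat n m"
      by (rule mult_carrier_mat[of _ n n]) auto
    moreover have "(A + U * B) * - U = - ((A + U * B) * U)"
      by (rule uminus_mult_right_mat) (simp add: carrier_matD[OF U] carrier_matD[OF B])
    ultimately show ?thesis by simp
  qed
  have e2: "B * - U + (D + B * U) = D"
    using carrier_matD[OF U] carrier_matD[OF B] carrier_matD[OF D] by (auto intro!: eq_matI)
  have "?K1 = ?P * ?K2 * ?R"
    unfolding PK
    by (subst mult_four_block_mat[of _ n n _ m _ m _ _ n _ m])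
      (auto simp: e1 e2 right_mult_one_mat[of _ n n] right_mult_one_mat[of _ m m]
        right_mult_one_mat[of _ n m] right_mult_zero_mat[of _ n m] right_mult_one_mat[OF B]
        right_add_zero_mat[OF B] right_add_zero_mat[of _ n n])
  then have "similar_mat ?K1 ?K2"
    by (intro similar_matI[of _ _ ?P ?R "n + m"] PR RP) auto
  then have "char_poly ?K1 = char_poly ?K2" by (rule char_poly_similar)
  then show ?thesis
    by (subst (asm) (1 2) char_poly_four_block_mat_upper_right_zero) (auto simp: mult.commute)
qed

section \<open>Indicator matrices of classes and blocks\<close>

lemma char_poly_diagonal:
  "char_poly (mat n n (\<lambda>(i, j). if i = j then d i else 0)) = (\<Prod>i<n. [:- d i, 1:])"
  by (subst char_poly_upper_triangular[of _ n])
    (auto simp: upper_triangular_def diag_mat_def prod.list_conv_set_nth atLeast0LessThan intro!: prod.cong)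

lemma mat_mult_entries:
  "mat n m f * mat m r g = mat n r (\<lambda>(i, j). \<Sum>l<m. f (i, l) * g (l, j))"
  by (rule eq_matI) (auto simp: scalar_prod_def atLeast0LessThan)

lemma sum_of_bool_lessThan:
  fixes n :: nat
  shows "(\<Sum>i<n. c * of_bool (P i)) = (c :: 'a :: comm_ring_1) * of_nat (card {i. i < n \<and> P i})"
proof -
  have "{i. i < n \<and> P i} = {..<n} \<inter> {i. P i}" by auto
  then show ?thesis by (simp only: sum_distrib_left[symmetric] sum_of_bool_eq finite_lessThan)
qed

lemma sum_of_bool_eq_mult:
  fixes k :: nat
  shows "k < r \<Longrightarrow> (\<Sum>l<r. of_bool (k = l) * h l) = (h k :: 'a :: comm_ring_1)"
proof -
  assume "k < r"
  have "(\<Sum>l<r. of_bool (k = l) * h l) = (\<Sum>l<r. if l = k then h l else 0)"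
    by (rule sum.cong) auto
  then show ?thesis using \<open>k < r\<close> by simp
qed

text \<open>The classes are disjoint with \<open>s\<close> elements each, so \<open>B * V\<close> is
  the scalar matrix \<open>c * s\<close>, and the update identity applies with identity matrices as
  \<open>A\<close> and \<open>D\<close>. The factor on the left replaces an exponent
  \<open>n - m\<close>, which would truncate when \<open>s = 0\<close> and
  \<open>m > n\<close>.\<close>

lemma char_poly_one_plus_classes:
  fixes c :: "'a :: idom" and g :: "nat \<Rightarrow> nat"
  assumes size: "\<And>t. t < m \<Longrightarrow> card {i. i < n \<and> g i = t} = s"
  shows "char_poly (mat n n (\<lambda>(i, j). of_bool (i = j) + c * of_bool (g i = g j \<and> g i < m)))
      * [:- 1, 1:] ^ m = [:- 1, 1:] ^ n * [:- (1 + c * of_nat s), 1:] ^ m"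
proof -
  define V where "V = mat n m (\<lambda>(i, t). of_bool (g i = t) :: 'a)"
  define B where "B = mat m n (\<lambda>(t, i). c * of_bool (g i = t))"
  \<comment> \<open>Summing over the classes \<open>t < m\<close> detects a common class of
    \<open>i\<close> and \<open>j\<close>; values of \<open>g\<close> from \<open>m\<close> on
    contribute nothing.\<close>
  have VB: "1\<^sub>m n + V * B
      = mat n n (\<lambda>(i, j). of_bool (i = j) + c * of_bool (g i = g j \<and> g i < m))"
    unfolding V_def B_def mat_mult_entries
    by (rule eq_matI) (auto simp: of_bool_def if_distrib[of "\<lambda>x. _ * x"] sum.delta cong: if_cong)
  have BV: "1\<^sub>m m + B * V = mat m m (\<lambda>(t, u). if t = u then 1 + c * of_nat s else 0)"
  proof (rule eq_matI)
    fix t u assume "t < dim_row (mat m m (\<lambda>(t, u). if t = u then 1 + c * of_nat s else 0))"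
      "u < dim_col (mat m m (\<lambda>(t, u). if t = u then 1 + c * of_nat s else 0))"
    then have tu: "t < m" "u < m" by auto
    have "(\<Sum>i<n. c * of_bool (g i = t) * of_bool (g i = u))
        = (\<Sum>i<n. c * of_bool (g i = t \<and> t = u))" by (rule sum.cong) auto
    also have "\<dots> = (if t = u then c * of_nat s else 0)"
      using size[OF tu(1)] by (cases "t = u") (simp_all add: sum_of_bool_lessThan)
    finally show "(1\<^sub>m m + B * V) $$ (t, u)
        = mat m m (\<lambda>(t, u). if t = u then 1 + c * of_nat s else 0) $$ (t, u)"
      using tu by (auto simp: V_def B_def mat_mult_entries)
  qed (auto simp: V_def B_def)
  have one: "char_poly (1\<^sub>m l :: 'a mat) = [:- 1, 1:] ^ l" for l
    using char_poly_diagonal[of l "\<lambda>_. 1"] by (simp add: one_mat_def)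
  have "char_poly (1\<^sub>m n + V * B) * char_poly (1\<^sub>m m)
      = char_poly (1\<^sub>m n) * char_poly (1\<^sub>m m + B * V)"
    by (rule char_poly_intertwined_update[of _ n _ m]) (auto simp: V_def B_def)
  then show ?thesis
    by (simp only: VB BV one char_poly_diagonal prod_constant card_lessThan)
qed

text \<open>\<open>f i\<close> is the block of the index \<open>i\<close>, and \<open>g i\<close> its twin class if \<open>g i < m\<close>; indices with
  \<open>g i \<ge> m\<close> belong to no class.\<close>

lemma block_indicator_factorization:
  fixes c :: "'a :: idom" and f g :: "nat \<Rightarrow> nat" and W :: "nat \<Rightarrow> nat \<Rightarrow> 'a"
  assumes f: "\<And>i. i < n \<Longrightarrow> f i < r"
    and size: "\<And>t. t < m \<Longrightarrow> card {i. i < n \<and> g i = t} = s"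
    and nest: "\<And>i j. i < n \<Longrightarrow> j < n \<Longrightarrow> g i = g j \<Longrightarrow> g i < m \<Longrightarrow> f i = f j"
    and F: "\<And>i. i < n \<Longrightarrow> g i < m \<longleftrightarrow> f i \<in> F"
  defines "lam \<equiv> \<lambda>a. 1 + c * (if a \<in> F then of_nat s else 0)"
  defines "S \<equiv> mat n n (\<lambda>(i, j). of_bool (i = j) + c * of_bool (g i = g j \<and> g i < m)
             + W (f i) (f j))"
    and "Q \<equiv> mat r r (\<lambda>(a, b). (if a = b then lam a else 0)
             + W a b * of_nat (card {j. j < n \<and> f j = b}))"
    and "U \<equiv> mat n r (\<lambda>(i, a). of_bool (f i = a))"
  shows "S * U = U * Q"
    and "char_poly S * (\<Prod>a<r. [:- lam a, 1:]) * [:- 1, 1:] ^ m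
      = [:- 1, 1:] ^ n * [:- (1 + c * of_nat s), 1:] ^ m * char_poly Q"
proof -
  define B where "B = mat r n (\<lambda>(a, j). W a (f j))"
  define L where "L = mat n n (\<lambda>(i, j). of_bool (i = j) + c * of_bool (g i = g j \<and> g i < m))"
  define D where "D = mat r r (\<lambda>(a, b). if a = b then lam a else 0)"
  have carr [simp]: "U \<in> carrier_mat n r" "B \<in> carrier_mat r n" "L \<in> carrier_mat n n"
    "D \<in> carrier_mat r r" by (auto simp: U_def B_def L_def D_def)
  have S: "S = L + U * B"
    unfolding S_def L_def U_def B_def mat_mult_entries
    by (rule eq_matI) (simp_all add: f sum_of_bool_eq_mult del: sum_mult_of_bool_eq sum_of_bool_mult_eq)
  have Q: "Q = D + B * U"
    unfolding Q_def D_def U_def B_def mat_mult_entries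
  proof (rule eq_matI, goal_cases)
    case (1 a b)
    then have "a < r" "b < r" by auto
    moreover have "(\<Sum>l<n. W a (f l) * of_bool (f l = b)) = (\<Sum>l<n. W a b * of_bool (f l = b))"
      by (rule sum.cong) auto
    moreover have "{..<n} \<inter> {l. f l = b} = {l. l < n \<and> f l = b}" by auto
    ultimately show ?case by simp
  qed auto
  \<comment> \<open>In row \<open>i\<close> the identity contributes 1 to the block of
    \<open>i\<close>. The class of \<open>i\<close>, if there is one, lies in the same block by
    \<open>nest\<close> and contributes \<open>c * s\<close>. By the fact \<open>F\<close>, its
    existence depends on the block alone, so the coefficient is \<open>lam\<close> of the
    block.\<close>
  have LU: "L * U = U * D"
    unfolding L_def D_def U_def mat_mult_entries
  proof (rule eq_matI, goal_cases)
    case (1 i a)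
    then have i: "i < n" and a: "a < r" by auto
    have "(\<Sum>l<n. (of_bool (i = l) + c * of_bool (g i = g l \<and> g i < m)) * of_bool (f l = a))
        = (\<Sum>l<n. of_bool (f i = a) * of_bool (l = i))
          + (\<Sum>l<n. c * of_bool (f i = a \<and> g i < m) * of_bool (g l = g i))"
      unfolding sum.distrib[symmetric]
    proof (rule sum.cong)
      fix l assume "l \<in> {..<n}"
      then have "g l = g i \<Longrightarrow> g i < m \<Longrightarrow> f l = f i" using nest[OF i, of l] by simp
      then show "(of_bool (i = l) + c * of_bool (g i = g l \<and> g i < m)) * of_bool (f l = a)
          = of_bool (f i = a) * of_bool (l = i)
            + c * of_bool (f i = a \<and> g i < m) * of_bool (g l = g i)"
      proof (cases "g l = g i \<and> g i < m")
        case True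
        with \<open>g l = g i \<Longrightarrow> g i < m \<Longrightarrow> f l = f i\<close> have "f l = f i" by blast
        with True show ?thesis
          by (cases "f i = a"; cases "l = i") simp_all
      next
        case False
        then have "\<not> (g i = g l \<and> g i < m)" by metis
        with False show ?thesis by (cases "l = i") simp_all
      qed
    qed simp
    also have "\<dots> = of_bool (f i = a)
        + c * of_bool (f i = a \<and> g i < m) * of_nat (card {l. l < n \<and> g l = g i})"
    proof -
      have "{l. l < n \<and> l = i} = {i}" using i by auto
      then show ?thesis by (simp only: sum_of_bool_lessThan) simp
    qed
    also have "\<dots> = (if f i = a then lam a else 0)"
      using size[of "g i"] F[OF i] by (auto simp: lam_def)
    also have "\<dots> = (\<Sum>l<r. of_bool (f i = l) * (if l = a then lam l else 0))"
      by (subst sum_of_bool_eq_mult[OF f[OF i]]) auto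
    finally show ?case using i a by simp
  qed auto
  show "S * U = U * Q"
    unfolding S Q
    by (rule intertwined_update[of _ n _ r]) (simp_all add: LU)
  have "char_poly (L + U * B) * char_poly D = char_poly L * char_poly (D + B * U)"
    by (rule char_poly_intertwined_update[of _ n _ r]) (simp_all add: LU)
  then have "char_poly S * (\<Prod>a<r. [:- lam a, 1:]) * [:- 1, 1:] ^ m
      = char_poly L * [:- 1, 1:] ^ m * char_poly Q"
    unfolding S Q by (simp add: D_def char_poly_diagonal mult_ac)
  also have "char_poly L * [:- 1, 1:] ^ m = [:- 1, 1:] ^ n * [:- (1 + c * of_nat s), 1:] ^ m"
    unfolding L_def by (rule char_poly_one_plus_classes) (rule size)
  finally show "char_poly S * (\<Prod>a<r. [:- lam a, 1:]) * [:- 1, 1:] ^ m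
      = [:- 1, 1:] ^ n * [:- (1 + c * of_nat s), 1:] ^ m * char_poly Q" .
qed

section \<open>Numbering the edges of the double star\<close>

locale double_hyperstar_params =
  fixes n1 n2 k :: nat
  assumes n1: "n1 \<ge> 2" and n2: "n2 \<ge> 2" and k: "k \<ge> 3"
begin

abbreviation m :: nat where "m \<equiv> n1 + n2 - 2"

abbreviation H where "H \<equiv> double_hyperstar n1 n2 k"

text \<open>The pendant edges of the double star are numbered by \<open>t < m\<close>, those at the first centre
  coming first; the number \<open>m\<close> stands for the central edge. The \<open>label\<close> of a vertex of degree one
  is the number of its hyperedge; the two centres also get the label \<open>m\<close>, which makes them
  vertices of no pendant class.\<close>

definition tip :: "nat \<Rightarrow> nat + nat" where
  "tip t = (if t < n1 - 1 then Inl (t + 1) else Inr (t + 2 - n1))"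

definition edge :: "nat \<Rightarrow> (nat + nat) set" where
  "edge t = (if t < n1 - 1 then {Inl 0, tip t} else if t < m then {Inr 0, tip t}
     else {Inl 0, Inr 0})"

definition label :: "(nat + nat) power_vertex \<Rightarrow> nat" where
  "label v = (case v of
     Old (Inl i) \<Rightarrow> if i = 0 then m else i - 1
   | Old (Inr i) \<Rightarrow> if i = 0 then m else n1 - 2 + i
   | New e j \<Rightarrow> inv_into {..m} edge e)"

text \<open>The numbers follow the order of \<open>double_hyperstar_blocks\<close>. The centres are
  tested first, since the label \<open>m\<close> does not separate them from the vertices added to
  the central edge.\<close>

definition block :: "(nat + nat) power_vertex \<Rightarrow> nat" where
  "block v = (if v = Old (Inl 0) then 0 else if v = Old (Inr 0) then 2
     else if label v < n1 - 1 then 1 else if label v < m then 3 else 4)"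

text \<open>The numbers of the hyperedges through a vertex; they turn counting common hyperedges
  into intersecting sets of numbers.\<close>

definition incident :: "(nat + nat) power_vertex \<Rightarrow> nat set" where
  "incident v = (if v = Old (Inl 0) then insert m {..<n1 - 1}
     else if v = Old (Inr 0) then {n1 - 1..m} else {label v})"

text \<open>Ensures that \<open>inv_into\<close> in \<open>label\<close> recovers the number of an
  edge.\<close>

lemma inj_edge: "inj_on edge {..m}"
  using n1 n2 by (auto simp: inj_on_def edge_def tip_def doubleton_eq_iff split: if_splits)

lemma star_edges_Inl: "image Inl ` hyperedges (star n1) = edge ` {..<n1 - 1}"
proof -
  have "{0, i} \<in> (\<lambda>t. {0, t + 1}) ` {..<n1 - 1}" if "1 \<le> i" "i < n1" for i
    using that by (intro image_eqI[of _ _ "i - 1"]) auto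
  then have "hyperedges (star n1) = (\<lambda>t. {0, t + 1}) ` {..<n1 - 1}"
    by (auto simp: star_def)
  then show ?thesis by (simp add: image_image edge_def tip_def)
qed

lemma star_edges_Inr: "image Inr ` hyperedges (star n2) = edge ` {n1 - 1..<m}"
proof -
  \<comment> \<open>The witness \<open>i + n1 - 2\<close> inverts \<open>t + 2 - n1\<close>: the
    first edge at the second centre has number \<open>n1 - 1\<close> and tip
    \<open>Inr 1\<close>.\<close>
  have "{0, i} \<in> (\<lambda>t. {0, t + 2 - n1}) ` {n1 - 1..<m}" if "1 \<le> i" "i < n2" for i
    using that n1 by (intro image_eqI[of _ _ "i + n1 - 2"]) auto
  moreover have "\<exists>i. {0, t + 2 - n1} = {0, i} \<and> 1 \<le> i \<and> i < n2" if "n1 - 1 \<le> t" "t < m" for t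
    using that n1 by (intro exI[of _ "t + 2 - n1"]) auto
  ultimately have "hyperedges (star n2) = (\<lambda>t. {0, t + 2 - n1}) ` {n1 - 1..<m}"
    by (auto simp: star_def)
  then show ?thesis by (simp add: image_image edge_def tip_def)
qed

lemma hyperedges_double_star: "hyperedges (double_star n1 n2) = edge ` {..m}"
proof -
  have "{..m} = {..<n1 - 1} \<union> {n1 - 1..<m} \<union> {m}" using n1 n2 by auto
  moreover have "edge m = {Inl 0, Inr 0}" using n2 by (auto simp: edge_def)
  ultimately show ?thesis
    by (simp add: double_star_def star_edges_Inl star_edges_Inr image_Un)
qed

lemma hyperedges_H: "hyperedges H = (\<lambda>t. power_edge k (edge t)) ` {..m}"
  by (simp add: double_hyperstar_def power_hypergraph_def hyperedges_double_star image_image)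

text \<open>Since \<open>k \<ge> 3\<close>, every hyperedge contains an added vertex, and that
  vertex carries the edge it was added to.\<close>

lemma inj_hyperedge: "inj_on (\<lambda>t. power_edge k (edge t)) {..m}"
proof (rule inj_onI)
  fix s t assume *: "s \<in> {..m}" "t \<in> {..m}" "power_edge k (edge s) = power_edge k (edge t)"
  have "New (edge s) 0 \<in> power_edge k (edge s)" using k by (auto simp: power_edge_def)
  with * have "edge s = edge t" by (auto simp: power_edge_def)
  with * show "s = t" using inj_edge by (auto dest: inj_onD)
qed

lemma label_New: "t \<le> m \<Longrightarrow> label (New (edge t) j) = t"
  using inj_edge by (simp add: label_def)

lemma label_tip: "t < m \<Longrightarrow> label (Old (tip t)) = t"
  using n1 by (auto simp: label_def tip_def)

lemma verts_H: "verts H = {Old (Inl 0), Old (Inr 0)} \<union> (\<lambda>t. Old (tip t)) ` {..<m}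
    \<union> (\<Union>t\<le>m. New (edge t) ` {..<k - 2})"
proof -
  have "verts (double_star n1 n2) = {Inl 0, Inr 0} \<union> tip ` {..<m}"
  proof (intro equalityI subsetI)
    fix w assume "w \<in> verts (double_star n1 n2)"
    then consider "w = Inl 0" | "w = Inr 0" | i where "w = Inl i" "0 < i" "i < n1"
      | i where "w = Inr i" "0 < i" "i < n2"
      by (auto simp: double_star_def star_def)
    then show "w \<in> {Inl 0, Inr 0} \<union> tip ` {..<m}"
    proof cases
      case (3 i)
      then have "w = tip (i - 1)" "i - 1 < m" using n2 by (auto simp: tip_def)
      then show ?thesis by blast
    next
      case (4 i)
      then have "w = tip (i + n1 - 2)" "i + n1 - 2 < m" using n1 by (auto simp: tip_def)
      then show ?thesis by blast
    qed auto
  qed (use n1 n2 in \<open>auto simp: double_star_def star_def tip_def\<close>)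
  then show ?thesis
    by (simp add: double_hyperstar_def power_hypergraph_def hyperedges_double_star image_Un
        image_image Un_assoc)
qed

lemma vertex_cases:
  assumes "v \<in> verts H"
  obtains (left) "v = Old (Inl 0)" | (right) "v = Old (Inr 0)"
    | (tip) t where "v = Old (tip t)" "t < m" | (new) t j where "v = New (edge t) j" "t \<le> m" "j < k - 2"
  using assms by (auto simp: verts_H)

section \<open>Incidence of vertices and hyperedges\<close>

lemma mem_hyperedge_iff:
  assumes "v \<in> verts H" and t: "t \<le> m"
  shows "v \<in> power_edge k (edge t) \<longleftrightarrow> t \<in> incident v"
  using assms(1)
proof (cases rule: vertex_cases)
  case left
  then show ?thesis using t n2 by (auto simp: power_edge_def edge_def incident_def tip_def)
next
  case right
  then show ?thesis using t n2 by (auto simp: power_edge_def edge_def incident_def tip_def)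
next
  case (tip s)
  then have "v \<in> power_edge k (edge t) \<longleftrightarrow> s = t"
    using t n1 by (auto simp: power_edge_def edge_def tip_def)
  moreover have "v \<noteq> Old (Inl 0)" "v \<noteq> Old (Inr 0)" using tip n1 by (auto simp: tip_def)
  ultimately show ?thesis using tip by (auto simp: incident_def label_tip)
next
  case (new s j)
  then have "v \<in> power_edge k (edge t) \<longleftrightarrow> s = t"
    using t inj_edge by (auto simp: power_edge_def dest: inj_onD)
  then show ?thesis using new by (auto simp: incident_def label_New)
qed

lemma label_centre: "label (Old (Inl 0)) = m" "label (Old (Inr 0)) = m"
  by (simp_all add: label_def)

lemma label_le:
  assumes "v \<in> verts H"
  shows "label v \<le> m"
  using assms by (cases rule: vertex_cases) (auto simp: label_tip label_New label_centre)

lemma incident_subset: "v \<in> verts H \<Longrightarrow> incident v \<subseteq> {..m}"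
  using n1 n2 by (auto simp: incident_def label_le)

text \<open>By \<open>inj_hyperedge\<close>, hyperedges may be counted by their numbers. One vertex
  gives degrees, two give adjacency entries. For empty \<open>A\<close> the intersection would be
  \<open>UNIV\<close>, whose \<open>card\<close> is 0.\<close>

lemma card_hyperedges:
  assumes "A \<subseteq> verts H" "A \<noteq> {}"
  shows "card {e \<in> hyperedges H. A \<subseteq> e} = card (\<Inter>v\<in>A. incident v)"
proof -
  have "{e \<in> hyperedges H. A \<subseteq> e}
      = (\<lambda>t. power_edge k (edge t)) ` {t \<in> {..m}. A \<subseteq> power_edge k (edge t)}"
    by (auto simp: hyperedges_H)
  also have "{t \<in> {..m}. A \<subseteq> power_edge k (edge t)} = (\<Inter>v\<in>A. incident v)"
    using assms mem_hyperedge_iff incident_subset by (auto simp: subset_iff)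
  finally have "{e \<in> hyperedges H. A \<subseteq> e}
      = (\<lambda>t. power_edge k (edge t)) ` (\<Inter>v\<in>A. incident v)" .
  moreover have "(\<Inter>v\<in>A. incident v) \<subseteq> {..m}" using assms incident_subset by blast
  ultimately show ?thesis using inj_hyperedge by (simp add: card_image inj_on_subset)
qed

lemma vertex_degree_H: "v \<in> verts H \<Longrightarrow> vertex_degree H v = card (incident v)"
  using card_hyperedges[of "{v}"] by (simp add: vertex_degree_def)

text \<open>Up to the correction for vertices of a common pendant hyperedge, the Seidel entry of two
  distinct vertices depends only on their blocks; the diagonal of \<open>sign\<close> is chosen so that the
  same formula also produces the zero diagonal of the Seidel matrix.\<close>

definition sign :: "nat \<Rightarrow> nat \<Rightarrow> real" where
  "sign a b =
     [[-1, -1, -1,  1, -1],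
      [-1,  1,  1,  1,  1],
      [-1,  1, -1, -1, -1],
      [ 1,  1, -1,  1,  1],
      [-1,  1, -1,  1, -1]] ! a ! b"

section \<open>Seidel entries by vertex types\<close>

lemma vertex_types:
  assumes "v \<in> verts H"
  obtains (centre1) "v = Old (Inl 0)" "block v = 0" "label v = m" "incident v = insert m {..<n1 - 1}"
    | (centre2) "v = Old (Inr 0)" "block v = 2" "label v = m" "incident v = {n1 - 1..m}"
    | (pendant1) "block v = 1" "label v < n1 - 1" "label v < m" "incident v = {label v}"
    | (pendant2) "block v = 3" "\<not> label v < n1 - 1" "label v < m" "incident v = {label v}"
    | (middle) "block v = 4" "label v = m" "incident v = {m}"
proof -
  consider "v = Old (Inl 0)" | "v = Old (Inr 0)" | "v \<noteq> Old (Inl 0)" "v \<noteq> Old (Inr 0)" by blast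
  then show ?thesis
  proof cases
    case 1
    then show ?thesis by (intro centre1) (simp_all add: block_def incident_def label_centre)
  next
    case 2
    then show ?thesis by (intro centre2) (simp_all add: block_def incident_def label_centre)
  next
    case 3
    have le: "n1 - 1 \<le> m" using n2 by simp
    consider "label v < n1 - 1" | "\<not> label v < n1 - 1" "label v < m" | "label v = m"
      using label_le[OF assms] by linarith
    then show ?thesis
    proof cases
      case 1
      then show ?thesis
        by (intro pendant1) (use 3 le in \<open>simp_all add: block_def incident_def\<close>)
    next
      case 2
      then show ?thesis
        by (intro pendant2) (use 3 in \<open>simp_all add: block_def incident_def\<close>)
    next
      case 3
      then show ?thesis
        by (intro middle)
          (use \<open>v \<noteq> Old (Inl 0)\<close> \<open>v \<noteq> Old (Inr 0)\<close> le in \<open>simp_all add: block_def incident_def\<close>)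
    qed
  qed
qed

text \<open>Pendant blocks give \<open>1 - 2 + 1\<close>, all other blocks
  \<open>1 - 0 - 1\<close>.\<close>

lemma sign_diagonal:
  assumes "v \<in> verts H"
  shows "1 - 2 * of_bool (label v < m) + sign (block v) (block v) = 0"
  using assms by (cases rule: vertex_types) (simp_all add: sign_def)

text \<open>Distinct vertices share at most one hyperedge, so the right-hand side is 1 or -1. Within
  a pendant block \<open>sign\<close> is 1, and the label term lowers it to -1 for vertices of the
  same hyperedge; in all other cases the blocks decide adjacency.\<close>

lemma sign_off_diagonal:
  assumes u: "u \<in> verts H" and v: "v \<in> verts H" and "u \<noteq> v"
  shows "- 2 * of_bool (label u = label v \<and> label u < m) + sign (block u) (block v)
    = 1 - 2 * real (card {e \<in> hyperedges H. {u, v} \<subseteq> e})"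
proof -
  have "card {e \<in> hyperedges H. {u, v} \<subseteq> e} = card (incident u \<inter> incident v)"
    using card_hyperedges[of "{u, v}"] u v by simp
  \<comment> \<open>Hence the incidence sets of the two centres meet only in \<open>m\<close>, the
    central edge.\<close>
  moreover have "{..<n1 - 1} \<inter> {n1 - 1..m} = {}" "{n1 - 1..m} \<inter> {..<n1 - 1} = {}"
    and "n1 - 1 \<le> m"
    using n1 n2 by auto
  moreover have "- 2 * of_bool (label u = label v \<and> label u < m) + sign (block u) (block v)
    = 1 - 2 * real (card (incident u \<inter> incident v))"
    using u
  proof (cases rule: vertex_types)
    \<comment> \<open>By \<open>u \<noteq> v\<close> the second vertex is not the same centre, whose
      incidence set has several elements.\<close>
    case centre1
    note * = this
    from v show ?thesis
      by (cases rule: vertex_types) (use * calculation \<open>u \<noteq> v\<close> in \<open>simp_all add: sign_def\<close>)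
  next
    case centre2
    note * = this
    from v show ?thesis
      by (cases rule: vertex_types) (use * calculation \<open>u \<noteq> v\<close> in \<open>simp_all add: sign_def\<close>)
  next
    case pendant1
    note * = this
    from v show ?thesis
      by (cases rule: vertex_types) (use * calculation in \<open>auto simp: sign_def\<close>)
  next
    case pendant2
    note * = this
    from v show ?thesis
      by (cases rule: vertex_types) (use * calculation in \<open>auto simp: sign_def\<close>)
  next
    case middle
    note * = this
    from v show ?thesis
      by (cases rule: vertex_types) (use * calculation in \<open>auto simp: sign_def\<close>)
  qed
  ultimately show ?thesis by simp
qed

section \<open>Sizes of classes and blocks\<close>

text \<open>The class consists of the tip and the \<open>k - 2\<close> vertices added to its edge;
  the centres are excluded by their label \<open>m\<close>.\<close>

lemma card_label:
  assumes t: "t < m"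
  shows "card {v \<in> verts H. label v = t} = k - 1"
proof -
  have "{v \<in> verts H. label v = t} = insert (Old (tip t)) (New (edge t) ` {..<k - 2})"
  proof (intro equalityI subsetI)
    fix v assume v: "v \<in> {v \<in> verts H. label v = t}"
    then have "v \<in> verts H" by simp
    then show "v \<in> insert (Old (tip t)) (New (edge t) ` {..<k - 2})"
      using v t by (cases v rule: vertex_cases) (auto simp: label_tip label_New, auto simp: label_def)
  qed (use t in \<open>auto simp: verts_H label_tip label_New\<close>)
  then show ?thesis using k by (simp add: card_image inj_on_def card_insert_if image_iff)
qed

lemma finite_verts: "finite (verts H)"
  by (simp add: verts_H)

lemma block_singletons: "{v \<in> verts H. block v = 0} = {Old (Inl 0)}"
  "{v \<in> verts H. block v = 2} = {Old (Inr 0)}"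
  by (auto simp: block_def verts_H split: if_splits)

lemma block_labels: "{v \<in> verts H. block v = 1} = {v \<in> verts H. label v \<in> {..<n1 - 1}}"
  "{v \<in> verts H. block v = 3} = {v \<in> verts H. label v \<in> {n1 - 1..<m}}"
  using n2 by (auto simp: block_def label_def[of "Old (Inl 0)"] label_def[of "Old (Inr 0)"]
    split: if_splits)

lemma card_labels: "A \<subseteq> {..<m} \<Longrightarrow> card {v \<in> verts H. label v \<in> A} = card A * (k - 1)"
proof -
  assume A: "A \<subseteq> {..<m}"
  have "{v \<in> verts H. label v \<in> A} = (\<Union>t\<in>A. {v \<in> verts H. label v = t})" by auto
  then have "card {v \<in> verts H. label v \<in> A} = (\<Sum>t\<in>A. card {v \<in> verts H. label v = t})"
    using A finite_verts by (simp only:) (intro card_UN_disjoint; auto intro: finite_subset)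
  then show ?thesis using A by (simp add: card_label subset_iff)
qed

lemma block_middle: "{v \<in> verts H. block v = 4} = New {Inl 0, Inr 0} ` {..<k - 2}"
proof -
  have e: "edge m = {Inl 0, Inr 0}" using n2 by (auto simp: edge_def)
  show ?thesis
  proof (intro equalityI subsetI)
    fix v assume v: "v \<in> {v \<in> verts H. block v = 4}"
    then have "v \<in> verts H" by simp
    then show "v \<in> New {Inl 0, Inr 0} ` {..<k - 2}"
      using v e n1 by (cases v rule: vertex_cases)
        (auto simp: block_def label_tip label_New less_le split: if_splits)
  next
    fix v :: "(nat + nat) power_vertex" assume "v \<in> New {Inl 0, Inr 0} ` {..<k - 2}"
    then obtain j where "v = New (edge m) j" "j < k - 2" using e by auto
    then show "v \<in> {v \<in> verts H. block v = 4}"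
      using n2 by (auto simp: block_def label_New verts_H)
  qed
qed

text \<open>The centres have degrees \<open>n1\<close> and \<open>n2\<close>, both at least 2, and
  their label \<open>m\<close> is outside \<open>A\<close>. Any other vertex lies only in the
  hyperedge numbered by its label.\<close>

lemma degree_one_verts_H:
  assumes "A \<subseteq> {..<m}"
  shows "degree_one_verts H (power_edge k ` edge ` A) = {v \<in> verts H. label v \<in> A}"
proof -
  have sub: "power_edge k (edge t) \<subseteq> verts H" if "t \<in> A" for t
  proof -
    have "power_edge k (edge t) \<in> hyperedges H" using that assms by (auto simp: hyperedges_H)
    then show ?thesis
      using is_hypergraph_double_hyperstar[of n1 n2 k] n1 n2 by (auto simp: is_hypergraph_def)
  qed
  have mem: "(\<exists>t\<in>A. v \<in> power_edge k (edge t)) \<and> vertex_degree H v = 1 \<longleftrightarrow> label v \<in> A"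
    if v: "v \<in> verts H" for v
  proof -
    have "(\<exists>t\<in>A. v \<in> power_edge k (edge t)) \<longleftrightarrow> A \<inter> incident v \<noteq> {}"
      using mem_hyperedge_iff[OF v] assms by (meson disjoint_iff le_refl lessThan_iff less_imp_le subset_iff)
    moreover have "card (incident v) = 1 \<longleftrightarrow> v \<noteq> Old (Inl 0) \<and> v \<noteq> Old (Inr 0)"
      using n1 n2 by (auto simp: incident_def card_insert_if)
    moreover have "v = Old (Inl 0) \<or> v = Old (Inr 0) \<Longrightarrow> label v \<notin> A"
      using assms by (auto simp: label_centre)
    ultimately show ?thesis
      by (auto simp: vertex_degree_H[OF v] incident_def)
  qed
  show ?thesis
  proof (intro equalityI subsetI)
    fix v assume "v \<in> degree_one_verts H (power_edge k ` edge ` A)"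
    then have "\<exists>t\<in>A. v \<in> power_edge k (edge t)" "vertex_degree H v = 1"
      by (auto simp: degree_one_verts_def)
    moreover from this(1) have "v \<in> verts H" using sub by blast
    ultimately show "v \<in> {v \<in> verts H. label v \<in> A}" using mem[of v] by simp
  next
    fix v assume "v \<in> {v \<in> verts H. label v \<in> A}"
    with mem[of v] show "v \<in> degree_one_verts H (power_edge k ` edge ` A)"
      by (simp add: degree_one_verts_def)
  qed
qed

lemma double_hyperstar_blocks_eq:
  "double_hyperstar_blocks n1 n2 k = map (\<lambda>a. {v \<in> verts H. block v = a}) [0..<5]"
proof -
  have deg: "degree_one_verts H (power_edge k ` edge ` {..<n1 - 1})
        = {v \<in> verts H. label v \<in> {..<n1 - 1}}"
      "degree_one_verts H (power_edge k ` edge ` {n1 - 1..<m})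
        = {v \<in> verts H. label v \<in> {n1 - 1..<m}}"
    by (rule degree_one_verts_H; use n2 in auto)+
  have "double_hyperstar_blocks n1 n2 k = map (\<lambda>a. {v \<in> verts H. block v = a}) [0, 1, 2, 3, 4]"
    by (simp only: double_hyperstar_blocks_def star_edges_Inl star_edges_Inr list.map
        block_singletons block_middle block_labels deg)
  also have "[0, 1, 2, 3, 4] = [0..<5::nat]" by (simp add: upt_rec)
  finally show ?thesis .
qed

lemma block_less: "block v < 5"
  by (simp add: block_def)

lemma card_block:
  assumes "a < 5"
  shows "real (card {v \<in> verts H. block v = a})
    = [1, (real n1 - 1) * (real k - 1), 1, (real n2 - 1) * (real k - 1), real k - 2] ! a"
proof -
  consider "a = 0" | "a = 1" | "a = 2" | "a = 3" | "a = 4" using assms by linarith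
  then show ?thesis
  proof cases
    case 2
    have "card {v \<in> verts H. label v \<in> {..<n1 - 1}} = card {..<n1 - 1} * (k - 1)"
      by (rule card_labels) (use n2 in auto)
    also have "card {..<n1 - 1} = n1 - 1" by simp
    finally have "real (card {v \<in> verts H. block v = 1}) = real (n1 - 1) * real (k - 1)"
      by (simp only: block_labels of_nat_mult)
    moreover have "real (n1 - 1) = real n1 - 1" "real (k - 1) = real k - 1"
      using n1 k by (simp_all add: of_nat_diff)
    ultimately show ?thesis using 2 by simp
  next
    case 4
    have "card {v \<in> verts H. label v \<in> {n1 - 1..<m}} = card {n1 - 1..<m} * (k - 1)"
      by (rule card_labels) auto
    also have "card {n1 - 1..<m} = n2 - 1" using n1 by simp
    finally have "real (card {v \<in> verts H. block v = 3}) = real (n2 - 1) * real (k - 1)"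
      by (simp only: block_labels of_nat_mult)
    moreover have "real (n2 - 1) = real n2 - 1" "real (k - 1) = real k - 1"
      using n2 k by (simp_all add: of_nat_diff)
    ultimately show ?thesis using 4 by simp
  next
    case 5
    then show ?thesis using k by (simp add: block_middle card_image inj_on_def of_nat_diff)
  qed (simp_all add: block_singletons)
qed

lemma block_of_pendant:
  assumes "v \<in> verts H" "label v < m"
  shows "block v = (if label v < n1 - 1 then 1 else 3)"
  using assms(1) by (cases rule: vertex_types) (use assms(2) in auto)

lemma block_eq_if_label_eq:
  "u \<in> verts H \<Longrightarrow> v \<in> verts H \<Longrightarrow> label u = label v \<Longrightarrow> label u < m \<Longrightarrow> block u = block v"
  by (simp add: block_of_pendant)

lemma label_less_iff_block:
  "v \<in> verts H \<Longrightarrow> label v < m \<longleftrightarrow> block v \<in> {1, 3}"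
  by (cases v rule: vertex_types) auto

text \<open>The summand \<open>m + 3\<close> is the power of the linear factor with root 1 that will
  be cancelled from the characteristic polynomial identity; the rest is the exponent that
  remains.\<close>

lemma card_verts: "card (verts H) = (k - 2) * (n1 + n2 - 1) - 1 + (m + 3)"
proof -
  have "verts H = (\<Union>a\<in>{..<5}. {v \<in> verts H. block v = a})" using block_less by auto
  also have "card \<dots> = (\<Sum>a<5. card {v \<in> verts H. block v = a})"
    using finite_verts by (intro card_UN_disjoint) auto
  finally have "real (card (verts H)) = (\<Sum>a<5. real (card {v \<in> verts H. block v = a}))"
    by simp
  also have "\<dots> = (\<Sum>a<5. [1, (real n1 - 1) * (real k - 1), 1, (real n2 - 1) * (real k - 1),
      real k - 2] ! a)"
    by (intro sum.cong) (simp_all add: card_block)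
  also have "\<dots> = (real k - 2) * (real n1 + real n2 - 1) - 1 + (real n1 + real n2 - 2 + 3)"
    by (simp add: eval_nat_numeral algebra_simps)
  also have "\<dots> = real ((k - 2) * (n1 + n2 - 1) - 1 + (m + 3))"
  proof -
    \<comment> \<open>The product is at least 1, so subtracting 1 in the naturals does not
      truncate.\<close>
    have "1 * 1 \<le> (k - 2) * (n1 + n2 - 1)" by (rule mult_le_mono) (use k n1 in auto)
    then have "real ((k - 2) * (n1 + n2 - 1) - 1) = real (k - 2) * real (n1 + n2 - 1) - 1"
      by (subst of_nat_diff) simp_all
    moreover have "real (k - 2) = real k - 2" "real (n1 + n2 - 1) = real n1 + real n2 - 1"
      "real m = real n1 + real n2 - 2"
      using n1 n2 k by (simp_all add: of_nat_diff)
    ultimately show ?thesis by (simp only: of_nat_add of_nat_numeral)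
  qed
  finally show ?thesis by (simp only: of_nat_eq_iff)
qed

section \<open>Entries of the quotient matrix\<close>

lemma quotient_carrier:
  "double_hyperstar_quotient (real n1) (real n2) (real k) \<in> carrier_mat 5 5"
proof -
  have "mat_of_rows_list 5 rows \<in> carrier_mat 5 5" if "length rows = 5" for rows :: "real list list"
    unfolding mat_of_rows_list_def that by (rule mat_carrier)
  then show ?thesis unfolding double_hyperstar_quotient_def by simp
qed

text \<open>This is \<open>Q = D + B U\<close> entrywise: the diagonal part is \<open>3 - 2k\<close>
  on the pendant blocks and 1 elsewhere, the rest is a sign times a block size.\<close>

lemma quotient_entry:
  assumes "a < 5" "b < 5"
  shows "double_hyperstar_quotient (real n1) (real n2) (real k) $$ (a, b)
    = (if a = b then 1 + - 2 * (if a \<in> {1, 3} then real (k - 1) else 0) else 0)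
      + sign a b * real (card {v \<in> verts H. block v = b})"
proof -
  have kr: "real (k - 1) = real k - 1" using k by (simp add: of_nat_diff)
  have entry: "mat_of_rows_list 5 [r0, r1, r2, r3, r4] $$ (a, b) = [r0, r1, r2, r3, r4] ! a ! b"
    for r0 r1 r2 r3 r4 :: "real list"
    using assms by (simp add: mat_of_rows_list_def)
  note nth = nth_Cons_0 nth_Cons_Suc nth_Cons_numeral pred_numeral_simps BitM.simps numeral_One
    One_nat_def
  have "a \<in> {0, 1, 2, 3, 4}" "b \<in> {0, 1, 2, 3, 4}" using assms by auto
  then show ?thesis
    unfolding card_block[OF assms(2)] kr double_hyperstar_quotient_def sign_def entry
    by (elim insertE emptyE; simp only: nth; simp add: algebra_simps)
qed

section \<open>The Seidel matrix for an enumeration of the vertices\<close>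

context
  fixes vs :: "(nat + nat) power_vertex list"
  assumes vs: "distinct vs" "set vs = verts H"
begin

lemma nth_verts: "i < length vs \<Longrightarrow> vs ! i \<in> verts H"
  unfolding vs(2)[symmetric] by (rule nth_mem)

lemma card_indices: "card {i. i < length vs \<and> P (vs ! i)} = card {v \<in> verts H. P v}"
proof -
  have "{v \<in> verts H. P v} = (!) vs ` {i. i < length vs \<and> P (vs ! i)}"
    unfolding vs(2)[symmetric] by (auto simp: in_set_conv_nth)
  moreover have "inj_on ((!) vs) {i. i < length vs \<and> P (vs ! i)}"
    using vs(1) by (auto simp: inj_on_def nth_eq_iff_index_eq)
  ultimately show ?thesis by (simp add: card_image)
qed

text \<open>The shape required by \<open>block_indicator_factorization\<close>, with
  \<open>f\<close> the block, \<open>g\<close> the label, \<open>c = - 2\<close> and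
  \<open>W = sign\<close>.\<close>

lemma seidel_mat_H:
  "seidel_mat vs H = mat (length vs) (length vs) (\<lambda>(i, j). of_bool (i = j)
     + - 2 * of_bool (label (vs ! i) = label (vs ! j) \<and> label (vs ! i) < m)
     + sign (block (vs ! i)) (block (vs ! j)))"
proof (rule eq_matI, goal_cases)
  case (1 i j)
  then have i: "i < length vs" and j: "j < length vs" by auto
  show ?case
  proof (cases "i = j")
    case True
    then show ?thesis
      using i sign_diagonal[OF nth_verts[OF i]] by (simp add: seidel_mat_def adjacency_mat_def)
  next
    case False
    then have "vs ! i \<noteq> vs ! j" using i j vs(1) by (simp add: nth_eq_iff_index_eq)
    from sign_off_diagonal[OF nth_verts[OF i] nth_verts[OF j] this] show ?thesis
      using i j False by (simp add: seidel_mat_def adjacency_mat_def)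
  qed
qed (simp_all add: seidel_mat_def adjacency_mat_def)

lemma seidel_carrier: "seidel_mat vs H \<in> carrier_mat (length vs) (length vs)"
  by (simp add: seidel_mat_H)

text \<open>The first identity serves the equitable partition, the second the spectrum.\<close>

lemma seidel_block_factorization:
  fixes Q :: "real mat"
  defines "Q \<equiv> double_hyperstar_quotient (real n1) (real n2) (real k)"
    and "U \<equiv> mat (length vs) 5 (\<lambda>(i, a). of_bool (block (vs ! i) = a))"
  shows "seidel_mat vs H * U = U * Q"
    and "char_poly (seidel_mat vs H) = [:- 1, 1:] ^ ((k - 2) * (n1 + n2 - 1) - 1)
      * [:- (3 - 2 * real k), 1:] ^ (n1 + n2 - 4) * char_poly Q"
proof -
  have Q: "Q = mat 5 5 (\<lambda>(a, b).
      (if a = b then 1 + - 2 * (if a \<in> {1, 3} then real (k - 1) else 0) else 0)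
      + sign a b * real (card {j. j < length vs \<and> block (vs ! j) = b}))"
  proof (rule eq_matI, goal_cases)
    case (1 a b)
    then have "a < 5" "b < 5" by auto
    then show ?case
      by (simp only: Q_def quotient_entry card_indices[of "\<lambda>v. block v = b"] index_mat split)
  qed (use quotient_carrier in \<open>auto simp: Q_def\<close>)
  note fact = block_indicator_factorization[where f = "\<lambda>i. block (vs ! i)"
      and g = "\<lambda>i. label (vs ! i)" and n = "length vs" and r = 5 and m = m and s = "k - 1"
      and F = "{1, 3}" and c = "- 2 :: real" and W = sign]
  show "seidel_mat vs H * U = U * Q"
    unfolding seidel_mat_H U_def Q
    by (rule fact(1))
      (simp_all only: block_less nth_verts block_eq_if_label_eq label_less_iff_block
        card_indices[of "\<lambda>v. label v = _"] card_label)
  let ?p = "[:- 1, 1:] :: real poly" and ?q = "[:- (3 - 2 * real k), 1:]"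
  have eq: "1 + - 2 * real (k - 1) = 3 - 2 * real k" using k by (simp add: of_nat_diff)
  have "char_poly (seidel_mat vs H)
      * (\<Prod>a<5::nat. [:- (1 + - 2 * (if a \<in> {1, 3} then real (k - 1) else 0)), 1:]) * ?p ^ m
      = ?p ^ length vs * [:- (1 + - 2 * real (k - 1)), 1:] ^ m * char_poly Q"
    unfolding seidel_mat_H Q
    by (rule fact(2))
      (simp_all only: block_less nth_verts block_eq_if_label_eq label_less_iff_block
        card_indices[of "\<lambda>v. label v = _"] card_label)
  also have "(\<Prod>a<5::nat. [:- (1 + - 2 * (if a \<in> {1, 3::nat} then real (k - 1) else 0)), 1:])
      = (\<Prod>a<5. if a \<in> {1, 3::nat} then ?q else ?p)"
    by (rule prod.cong) (use eq in auto)
  \<comment> \<open>The pendant blocks 1 and 3 contribute \<open>?q\<close>, the other three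
    \<open>?p\<close>.\<close>
  also have "\<dots> = ?p ^ 3 * ?q ^ 2"
    by (simp add: lessThan_nat_numeral eval_nat_numeral lessThan_Suc del: mult_pCons_left mult_pCons_right)
  finally have "char_poly (seidel_mat vs H) * (?p ^ 3 * ?q ^ 2) * ?p ^ m
      = ?p ^ length vs * ?q ^ m * char_poly Q" unfolding eq .
  moreover have "length vs = (k - 2) * (n1 + n2 - 1) - 1 + (m + 3)"
    using card_verts vs distinct_card by fastforce
  \<comment> \<open>Exact because \<open>n1 + n2 \<ge> 4\<close>; it splits off the square of
    \<open>?q\<close> that is cancelled below.\<close>
  moreover have "m = n1 + n2 - 4 + 2" using n1 n2 by simp
  ultimately have "char_poly (seidel_mat vs H) * (?p ^ (m + 3) * ?q ^ 2)
      = (?p ^ ((k - 2) * (n1 + n2 - 1) - 1) * ?q ^ (n1 + n2 - 4) * char_poly Q)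
        * (?p ^ (m + 3) * ?q ^ 2)"
    by (simp only: power_add mult_ac)
  moreover have "?p ^ (m + 3) * ?q ^ 2 \<noteq> 0" by simp
  ultimately show "char_poly (seidel_mat vs H) = ?p ^ ((k - 2) * (n1 + n2 - 1) - 1)
      * ?q ^ (n1 + n2 - 4) * char_poly Q"
    by (rule mult_right_cancel[THEN iffD1, rotated])
qed

text \<open>For the block indicator matrix \<open>U\<close>, entry \<open>(i, b)\<close> of
  \<open>S U\<close> is the sum of row \<open>i\<close> over block \<open>b\<close>, and that of
  \<open>U Q\<close> is \<open>Q $$ (a, b)\<close> for \<open>i\<close> in block \<open>a\<close>.
  So \<open>S U = U Q\<close> is the row sum condition.\<close>

lemma equitable_quotient_H:
  "equitable_quotient (seidel_mat vs H) (map (index_block vs) (double_hyperstar_blocks n1 n2 k))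
     (double_hyperstar_quotient (real n1) (real n2) (real k))"
proof -
  let ?B = "\<lambda>a. {i. i < length vs \<and> block (vs ! i) = a}"
  let ?Q = "double_hyperstar_quotient (real n1) (real n2) (real k)"
  have P: "map (index_block vs) (double_hyperstar_blocks n1 n2 k) = map ?B [0..<5]"
    using nth_verts by (auto simp: double_hyperstar_blocks_eq index_block_def)
  \<comment> \<open>Nonempty blocks make the list distinct and its set a partition; the lower bounds
    on \<open>n1\<close>, \<open>n2\<close> and \<open>k\<close> all enter here.\<close>
  have ne: "?B a \<noteq> {}" if "a < 5" for a
  proof -
    have "a \<in> {0, 1, 2, 3, 4}" using that by auto
    then have "real (card (?B a)) > 0"
      unfolding card_indices[of "\<lambda>v. block v = a"] card_block[OF that]
      using n1 n2 k by (elim insertE emptyE) simp_all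
    then show ?thesis by (metis card.empty of_nat_0 less_irrefl)
  qed
  have "inj_on ?B {0..<5}" using ne by (fastforce simp: inj_on_def)
  then have "distinct (map ?B [0..<5])" by (simp add: distinct_map)
  moreover have "partition_on {..<length vs} (set (map ?B [0..<5]))"
    using ne block_less by (auto simp: partition_on_def disjoint_def) blast
  moreover have "(\<Sum>j\<in>?B b. seidel_mat vs H $$ (i, j)) = ?Q $$ (a, b)"
    if "a < 5" "b < 5" "i \<in> ?B a" for a b i
  proof -
    let ?U = "mat (length vs) 5 (\<lambda>(i, a). of_bool (block (vs ! i) = a)) :: real mat"
    \<comment> \<open>Both matrices are written in the form \<open>mat\<close>, so that
      \<open>mat_mult_entries\<close> applies.\<close>
    have S: "seidel_mat vs H = mat (length vs) (length vs) (\<lambda>ij. seidel_mat vs H $$ ij)"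
      and Q: "?Q = mat 5 5 (\<lambda>ab. ?Q $$ ab)"
      by (rule eq_matI; use quotient_carrier in \<open>auto simp: seidel_mat_H\<close>)+
    have "(\<Sum>j\<in>?B b. seidel_mat vs H $$ (i, j))
        = (\<Sum>j<length vs. seidel_mat vs H $$ (i, j) * of_bool (block (vs ! j) = b))"
      by (intro sum.mono_neutral_cong_left) auto
    also have "\<dots> = (seidel_mat vs H * ?U) $$ (i, b)"
      using that by (subst S, subst mat_mult_entries) simp
    also have "\<dots> = (?U * ?Q) $$ (i, b)" by (simp only: seidel_block_factorization(1))
    also have "\<dots> = (\<Sum>l<5. of_bool (a = l) * ?Q $$ (l, b))"
      using that by (subst Q, subst mat_mult_entries) simp
    also have "\<dots> = ?Q $$ (a, b)" using that by (intro sum_of_bool_eq_mult)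
    finally show ?thesis .
  qed
  ultimately show ?thesis
    unfolding equitable_quotient_def P
    using quotient_carrier by (simp add: seidel_carrier carrier_matD(1)[OF seidel_carrier])
qed

end

end

section \<open>From characteristic polynomials to spectra\<close>

text \<open>Forming the characteristic polynomial commutes with the embedding of the reals into the
  complex numbers, and root multisets of nonzero factors add up.\<close>

lemma spectrum_mset_eqI:
  assumes "M \<in> carrier_mat n n" "Q \<in> carrier_mat r r"
    and "char_poly M = [:- x, 1:] ^ a * [:- y, 1:] ^ b * char_poly Q"
  shows "spectrum_mset M = replicate_mset a (complex_of_real x)
    + replicate_mset b (complex_of_real y) + spectrum_mset Q"
proof -
  have repeat: "repeat_mset c {#z#} = replicate_mset c z" for c and z :: complex
    by (induction c) auto
  interpret h: map_poly_comm_ring_hom complex_of_real ..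
  have "char_poly (map_mat complex_of_real M) = map_poly complex_of_real (char_poly M)"
    "char_poly (map_mat complex_of_real Q) = map_poly complex_of_real (char_poly Q)"
    using assms by (simp_all add: of_real_hom.char_poly_hom)
  then have "char_poly (map_mat complex_of_real M)
      = [:- complex_of_real x, 1:] ^ a * [:- complex_of_real y, 1:] ^ b
        * char_poly (map_mat complex_of_real Q)"
    unfolding assms(3) by (simp add: h.hom_mult h.hom_power)
  \<comment> \<open>A monic polynomial is nonzero, as \<open>proots_mult\<close> requires of each
    factor.\<close>
  moreover have "char_poly (map_mat complex_of_real Q) \<noteq> 0"
    using degree_monic_char_poly[of "map_mat complex_of_real Q" r] assms(2) by auto
  ultimately show ?thesis
    unfolding spectrum_mset_def
    by (simp add: proots_mult proots_power repeat)
qed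

text \<open>The characteristic polynomial has degree \<open>n\<close> and splits over the complex
  numbers.\<close>

lemma size_spectrum_mset: "M \<in> carrier_mat n n \<Longrightarrow> size (spectrum_mset M) = n"
  using degree_monic_char_poly[of "map_mat complex_of_real M" n]
  by (simp add: spectrum_mset_def size_proots_complex)

theorem theorem5p2:
  fixes n1 n2 k :: nat
    and vs :: "(nat + nat) power_vertex list"
  assumes "n1 \<ge> 2" and "n2 \<ge> 2" and "k \<ge> 3"
    and "distinct vs" and "set vs = verts (double_hyperstar n1 n2 k)"
  shows "equitable_quotient (seidel_mat vs (double_hyperstar n1 n2 k))
           (map (index_block vs) (double_hyperstar_blocks n1 n2 k))
           (double_hyperstar_quotient (real n1) (real n2) (real k))
       \<and> (\<exists>r1 r2 r3 r4 r5 :: complex.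
            spectrum_mset (double_hyperstar_quotient (real n1) (real n2) (real k))
              = {#r1, r2, r3, r4, r5#}
          \<and> spectrum_mset (seidel_mat vs (double_hyperstar n1 n2 k))
              = replicate_mset ((k - 2) * (n1 + n2 - 1) - 1) 1
                + replicate_mset (n1 + n2 - 4) (- 2 * of_nat k + 3)
                + {#r1, r2, r3, r4, r5#})"
proof -
  interpret double_hyperstar_params n1 n2 k by unfold_locales (use assms in auto)
  let ?Q = "double_hyperstar_quotient (real n1) (real n2) (real k)"
  note Q = quotient_carrier
  have "size (spectrum_mset ?Q) = 5" by (rule size_spectrum_mset[OF Q])
  \<comment> \<open>Any listing of the spectrum of \<open>?Q\<close> provides the five witnesses,
    repetitions included.\<close>
  moreover obtain rs where rs: "mset rs = spectrum_mset ?Q" using ex_mset by blast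
  ultimately have "length rs = 5" by (metis size_mset)
  then obtain r1 r2 r3 r4 r5 where "rs = [r1, r2, r3, r4, r5]"
    by (auto simp: eval_nat_numeral length_Suc_conv)
  with rs have r: "spectrum_mset ?Q = {#r1, r2, r3, r4, r5#}" by simp
  have "spectrum_mset (seidel_mat vs H)
      = replicate_mset ((k - 2) * (n1 + n2 - 1) - 1) (complex_of_real 1)
        + replicate_mset (n1 + n2 - 4) (complex_of_real (3 - 2 * real k)) + spectrum_mset ?Q"
    by (rule spectrum_mset_eqI[OF _ Q seidel_block_factorization(2)[OF assms(4,5)]])
      (rule seidel_carrier[OF assms(4,5)])
  then have "spectrum_mset (seidel_mat vs H)
      = replicate_mset ((k - 2) * (n1 + n2 - 1) - 1) 1
        + replicate_mset (n1 + n2 - 4) (- 2 * of_nat k + 3) + {#r1, r2, r3, r4, r5#}"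
    unfolding r by simp
  with equitable_quotient_H[OF assms(4,5)] r show ?thesis
    by (intro conjI exI)
qed

end
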